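(* Let $m,n$ be positive integers with $m<n$, let $\rho=m/n$, let $A\in\mathbb{R}^{m\times n}$, and let $\Theta_u,\Theta_v\in\mathbb{R}^{n\times n}$ be diagonal matrices with positive diagonal entries. Define the $2n\times 2n$ matrices $$H=\begin{bmatrix}\Theta_u^{-1}&0\\0&\Theta_v^{-1}\end{bmatrix}+\begin{bmatrix}A^{\mathsf T}A&-A^{\mathsf T}A\\-A^{\mathsf T}A&A^{\mathsf T}A\end{bmatrix},\qquad P=\begin{bmatrix}\Theta_u^{-1}+\rho I_n&-\rho I_n\\-\rho I_n&\Theta_v^{-1}+\rho I_n\end{bmatrix}.$$ Then the $2n$ eigenvalues of $P^{-1}H$, counted with multiplicity, are: 1. the eigenvalue $1$ with multiplicity $n$; and 2. the remaining $n$ eigenvalues, which are the eigenvalues (counted with multiplicity) of the $n\times n$ matrix $\tilde P^{-1}\tilde H$, where $\tilde H=\Theta^{-1}+A^{\mathsf T}A$, $\tilde P=\Theta^{-1}+\rho I_n$ and $\Theta=\Theta_u+\Theta_v=\operatorname{diag}(\Theta_1,\dots,\Theta_n)$. These eigenvalues $\lambda$ satisfy the following bounds. Suppose $m\le n/2$, let $C>0$ be any constant, let $l=\#\{j\in\{1,\dots,n\}:\Theta_j^{-1}<C\}$, and suppose $A$ satisfies property P2 (see context) for $k=l$ with some constant $\delta_l>0$. If $AA^{\mathsf T}=I_m$, then $$|\lambda-1|\le\delta_l+\frac14\,\frac{(3-\rho)^2}{\rho\,\delta_l\,C};$$ if $A$ satisfies property P1 (see context) with constant $\delta\ge 0$,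 then $$|\lambda-1|\le\delta_l+\frac14\,\frac{(1+\delta-\rho+2\sqrt{1+\delta})^2}{\rho\,\delta_l\,C}.$$
   Context: $I_k$ denotes the $k\times k$ identity matrix and $\|\cdot\|_2$ the spectral norm of a matrix. Property P1 with constant $\delta$ for $A\in\mathbb{R}^{m\times n}$: $\|AA^{\mathsf T}-I_m\|_2\le\delta$ (rows of $A$ are nearly orthonormal). Property P2 for $k$ with constant $\delta_k$ for $A\in\mathbb{R}^{m\times n}$: for every matrix $B$ composed of arbitrary $k$ (distinct) columns of $A$, $\left\|\frac{n}{m}B^{\mathsf T}B-I_k\right\|_2\le\delta_k$. (For $k=0$ the condition is vacuous.) *)

theory Defs
  imports
    "HOL-Computational_Algebra.Fundamental_Theorem_Algebra"
    "Jordan_Normal_Form.Char_Poly"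
    "Jordan_Normal_Form.Gauss_Jordan_Elimination"
begin

definition vec_norm2 :: "real vec \<Rightarrow> real" where
  "vec_norm2 v = sqrt (v \<bullet> v)"

text \<open>
  The supremum ranges over the closed unit ball rather than the unit sphere, so that
  it is over a nonempty set also for matrices without columns, whose norm is then 0.
\<close>

definition spectral_norm :: "real mat \<Rightarrow> real" where
  "spectral_norm M =
     (SUP v \<in> {v \<in> carrier_vec (dim_col M). vec_norm2 v \<le> 1}. vec_norm2 (M *\<^sub>v v))"

definition property_P1 :: "real mat \<Rightarrow> real \<Rightarrow> bool" where
  "property_P1 A \<delta> \<longleftrightarrow>
     spectral_norm (A * transpose_mat A - 1\<^sub>m (dim_row A)) \<le> \<delta>"

text \<open>
  The list \<open>js\<close> selects \<open>k\<close> distinct column indices; the selected columns themselves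
  may coincide as vectors. For \<open>k = 0\<close> the condition says \<open>0 \<le> \<delta>\<close>.
\<close>

definition property_P2 :: "real mat \<Rightarrow> nat \<Rightarrow> real \<Rightarrow> bool" where
  "property_P2 A k \<delta> \<longleftrightarrow>
     (\<forall>js. distinct js \<and> set js \<subseteq> {..<dim_col A} \<and> length js = k \<longrightarrow>
        (let B = mat_of_cols (dim_row A) (map (col A) js) in
         spectral_norm ((real (dim_col A) / real (dim_row A)) \<cdot>\<^sub>m (transpose_mat B * B) - 1\<^sub>m k)
           \<le> \<delta>))"

definition pos_diag_mat :: "nat \<Rightarrow> real mat \<Rightarrow> bool" where
  "pos_diag_mat n D \<longleftrightarrow> D \<in> carrier_mat n n \<and> diagonal_mat D \<and> (\<forall>i<n. 0 < D $$ (i, i))"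

text \<open>Unspecified for singular matrices.\<close>

definition mat_inv :: "real mat \<Rightarrow> real mat" where
  "mat_inv M = the (mat_inverse M)"

text \<open>
  Eigenvalues are taken over the complex numbers and counted with algebraic multiplicity;
  thus an \<open>n \<times> n\<close> matrix has exactly \<open>n\<close> of them.
\<close>

definition eigenvalues_mset :: "real mat \<Rightarrow> complex multiset" where
  "eigenvalues_mset M = proots (char_poly (map_mat complex_of_real M))"

lemma size_eigenvalues_mset:
  assumes "M \<in> carrier_mat n n"
  shows "size (eigenvalues_mset M) = n"
proof -
  have "map_mat complex_of_real M \<in> carrier_mat n n" using assms by simp
  from degree_monic_char_poly[OF this] show ?thesis
    unfolding eigenvalues_mset_def by (simp add: size_proots_complex)
qed

lemma in_eigenvalues_mset_iff:
  assumes "M \<in> carrier_mat n n"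
  shows "x \<in># eigenvalues_mset M \<longleftrightarrow> eigenvalue (map_mat complex_of_real M) x"
proof -
  have c: "map_mat complex_of_real M \<in> carrier_mat n n" using assms by simp
  have "char_poly (map_mat complex_of_real M) \<noteq> 0"
    using degree_monic_char_poly[OF c] by auto
  then show ?thesis
    unfolding eigenvalues_mset_def eigenvalue_root_char_poly[OF c] by simp
qed

end

theory Submission
  imports Defs "HOL-Analysis.L2_Norm"
begin

text \<open>
  Passing from \<open>(x\<^sub>1, x\<^sub>2)\<close> to \<open>(x\<^sub>1 - x\<^sub>2, x\<^sub>2)\<close> turns the preconditioned matrix into a block
  triangular one with diagonal blocks \<open>Pt\<^sup>-\<^sup>1 Ht\<close> and the identity. The eigenvalues of the former
  are real, and \<open>\<lambda> - 1\<close> is a Rayleigh quotient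
  \<open>(\<bar>A x\<bar>\<^sup>2 - \<rho> \<bar>x\<bar>\<^sup>2) / (x\<^sup>T \<Theta>\<^sup>-\<^sup>1 x + \<rho> \<bar>x\<bar>\<^sup>2)\<close>. Split \<open>x = y + z\<close> with \<open>y\<close> supported on the
  indices where \<open>\<Theta>\<^sup>-\<^sup>1 < C\<close>. Property P2 controls the numerator on \<open>y\<close>; the remaining terms
  contain a factor \<open>\<bar>z\<bar>\<close>, and the denominator is at least \<open>\<rho> \<bar>x\<bar>\<^sup>2 + C \<bar>z\<bar>\<^sup>2\<close>.
\<close>

section \<open>Euclidean norm, spectral norm and quadratic forms\<close>

lemma vec_norm2_eq_L2_set: "vec_norm2 v = L2_set (($) v) {0..<dim_vec v}"
  unfolding vec_norm2_def L2_set_def scalar_prod_def by (simp add: power2_eq_square)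

lemma scalar_prod_self_nonneg: "0 \<le> v \<bullet> (v :: real vec)"
  unfolding scalar_prod_def by (simp add: sum_nonneg)

lemma scalar_prod_self_pos:
  assumes "v \<in> carrier_vec n" and "v \<noteq> 0\<^sub>v n"
  shows "0 < v \<bullet> (v :: real vec)"
proof -
  obtain i where "i < n" "v $ i \<noteq> 0" using assms by (auto simp: vec_eq_iff)
  then show ?thesis
    unfolding scalar_prod_def using assms by (intro sum_pos2[of _ i]) auto
qed

lemma vec_norm2_power2: "(vec_norm2 v)\<^sup>2 = v \<bullet> v"
  unfolding vec_norm2_def by (simp add: scalar_prod_self_nonneg)

lemma vec_norm2_nonneg: "0 \<le> vec_norm2 v"
  unfolding vec_norm2_def by (simp add: scalar_prod_self_nonneg)

lemma vec_norm2_smult: "vec_norm2 (c \<cdot>\<^sub>v v) = \<bar>c\<bar> * vec_norm2 v"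
  unfolding vec_norm2_def by (simp add: real_sqrt_mult mult.assoc[symmetric])

lemma abs_scalar_prod_le:
  assumes "dim_vec v = dim_vec w"
  shows "\<bar>v \<bullet> w\<bar> \<le> vec_norm2 v * vec_norm2 w"
proof -
  have "\<bar>v \<bullet> w\<bar> \<le> (\<Sum>i = 0..<dim_vec w. \<bar>v $ i\<bar> * \<bar>w $ i\<bar>)"
    unfolding scalar_prod_def by (rule order_trans[OF sum_abs]) (simp add: abs_mult)
  also have "\<dots> \<le> vec_norm2 v * vec_norm2 w"
    unfolding vec_norm2_eq_L2_set assms by (rule L2_set_mult_ineq)
  finally show ?thesis .
qed

text \<open>Needed because the supremum in \<open>spectral_norm\<close> dominates the values below
  it only if they are bounded above. Cauchy-Schwarz in each row gives the Frobenius norm as a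
  bound.\<close>

lemma mult_mat_vec_norm_bounded:
  "\<exists>c. \<forall>v \<in> carrier_vec (dim_col M). vec_norm2 (M *\<^sub>v v) \<le> c * vec_norm2 v"
proof (intro exI ballI)
  fix v :: "real vec" assume v: "v \<in> carrier_vec (dim_col M)"
  have "(M *\<^sub>v v) \<bullet> (M *\<^sub>v v) = (\<Sum>i<dim_row M. (row M i \<bullet> v)\<^sup>2)"
    by (simp add: scalar_prod_def[of "M *\<^sub>v v"] power2_eq_square atLeast0LessThan)
  also have "\<dots> \<le> (\<Sum>i<dim_row M. (vec_norm2 (row M i) * vec_norm2 v)\<^sup>2)"
    using v by (intro sum_mono abs_le_square_iff[THEN iffD1])
      (simp add: abs_scalar_prod_le vec_norm2_nonneg)
  also have "\<dots> = (\<Sum>i<dim_row M. (vec_norm2 (row M i))\<^sup>2) * (vec_norm2 v)\<^sup>2"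
    by (simp add: power_mult_distrib sum_distrib_right)
  finally show "vec_norm2 (M *\<^sub>v v) \<le> sqrt (\<Sum>i<dim_row M. (vec_norm2 (row M i))\<^sup>2) * vec_norm2 v"
    unfolding vec_norm2_def[of "M *\<^sub>v v"]
    using real_sqrt_le_mono by (fastforce simp: real_sqrt_mult vec_norm2_nonneg)
qed

lemma vec_norm2_mult_mat_vec_le:
  assumes v: "v \<in> carrier_vec (dim_col M)"
  shows "vec_norm2 (M *\<^sub>v v) \<le> spectral_norm M * vec_norm2 v"
proof -
  let ?U = "{v \<in> carrier_vec (dim_col M). vec_norm2 v \<le> 1}"
  obtain c where c: "\<And>v. v \<in> carrier_vec (dim_col M) \<Longrightarrow> vec_norm2 (M *\<^sub>v v) \<le> c * vec_norm2 v"
    using mult_mat_vec_norm_bounded[of M] by blast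
  have bdd: "bdd_above ((\<lambda>v. vec_norm2 (M *\<^sub>v v)) ` ?U)"
  proof (rule bdd_aboveI2[of _ _ "\<bar>c\<bar>"])
    fix v assume "v \<in> ?U"
    then have "vec_norm2 (M *\<^sub>v v) \<le> c * vec_norm2 v" "vec_norm2 v \<le> 1" using c by auto
    moreover have "c * vec_norm2 v \<le> \<bar>c\<bar> * 1"
      using \<open>vec_norm2 v \<le> 1\<close> vec_norm2_nonneg[of v] by (intro mult_mono) auto
    ultimately show "vec_norm2 (M *\<^sub>v v) \<le> \<bar>c\<bar>" by simp
  qed
  show ?thesis
  \<comment> \<open>The definition of the norm applies to \<open>v\<close> after rescaling to length
    1. For length 0, the bound with \<open>c\<close> already forces the image to have norm
    0.\<close>
  proof (cases "vec_norm2 v = 0")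
    case True
    then show ?thesis using c[OF v] by simp
  next
    case False
    then have pos: "vec_norm2 v > 0" using vec_norm2_nonneg[of v] by simp
    let ?w = "(1 / vec_norm2 v) \<cdot>\<^sub>v v"
    have "?w \<in> ?U" using v pos by (simp add: vec_norm2_smult)
    from cSUP_upper[OF this bdd]
    have "vec_norm2 (M *\<^sub>v ?w) \<le> spectral_norm M" unfolding spectral_norm_def .
    moreover have "M *\<^sub>v ?w = (1 / vec_norm2 v) \<cdot>\<^sub>v (M *\<^sub>v v)"
      using v by (intro mult_mat_vec[of _ "dim_row M" "dim_col M"]) auto
    ultimately show ?thesis using pos by (simp add: vec_norm2_smult divide_simps)
  qed
qed

lemma abs_quadratic_form_le:
  assumes M: "M \<in> carrier_mat n n" and v: "v \<in> carrier_vec n" and "spectral_norm M \<le> c"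
  shows "\<bar>v \<bullet> (M *\<^sub>v v)\<bar> \<le> c * (v \<bullet> v)"
proof -
  have "\<bar>v \<bullet> (M *\<^sub>v v)\<bar> \<le> vec_norm2 v * vec_norm2 (M *\<^sub>v v)"
    using M v by (intro abs_scalar_prod_le) simp
  also have "\<dots> \<le> vec_norm2 v * (spectral_norm M * vec_norm2 v)"
    using M v by (intro mult_left_mono vec_norm2_mult_mat_vec_le vec_norm2_nonneg) auto
  also have "\<dots> = spectral_norm M * (v \<bullet> v)"
    by (simp add: vec_norm2_power2[symmetric] power2_eq_square)
  also have "\<dots> \<le> c * (v \<bullet> v)"
    using assms(3) scalar_prod_self_nonneg by (rule mult_right_mono)
  finally show ?thesis .
qed

lemma scalar_prod_gram:
  fixes A :: "real mat"
  assumes A: "A \<in> carrier_mat m n" and x: "x \<in> carrier_vec n" and y: "y \<in> carrier_vec n"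
  shows "x \<bullet> ((transpose_mat A * A) *\<^sub>v y) = (A *\<^sub>v x) \<bullet> (A *\<^sub>v y)"
proof -
  have AT: "transpose_mat A \<in> carrier_mat n m" using A by simp
  have "x \<bullet> (transpose_mat A *\<^sub>v (A *\<^sub>v y)) = (A *\<^sub>v x) \<bullet> (A *\<^sub>v y)"
    using transpose_vec_mult_scalar[OF AT _ x] A x y by (metis mult_mat_vec_carrier transpose_transpose)
  then show ?thesis using A AT y by (simp add: assoc_mult_mat_vec[OF AT A y])
qed

section \<open>Consequences of the properties P1 and P2\<close>

text \<open>P1 speaks of the rows, through \<open>A * transpose_mat A\<close>, whereas the Rayleigh
  quotient involves the Gram matrix of the columns. With \<open>y\<close> the image of
  \<open>x\<close> and \<open>z\<close> the image of \<open>y\<close> under the transpose, P1 bounds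
  the square of the norm of \<open>z\<close> by \<open>(1 + \<delta>) * (y \<bullet> y)\<close>, and
  Cauchy-Schwarz is applied to \<open>y \<bullet> y = z \<bullet> x\<close>.\<close>

lemma property_P1_norm_bound:
  assumes A: "A \<in> carrier_mat m n" and P1: "property_P1 A \<delta>" and "0 \<le> \<delta>"
    and x: "x \<in> carrier_vec n"
  shows "(A *\<^sub>v x) \<bullet> (A *\<^sub>v x) \<le> (1 + \<delta>) * (x \<bullet> x)"
proof -
  define y where "y = A *\<^sub>v x"
  define z where "z = transpose_mat A *\<^sub>v y"
  have y: "y \<in> carrier_vec m" and z: "z \<in> carrier_vec n" using A x by (auto simp: y_def z_def)
  have AT: "transpose_mat A \<in> carrier_mat n m" using A by simp
  have AAT: "A * transpose_mat A \<in> carrier_mat m m" using A by simp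
  have "z \<bullet> z = y \<bullet> ((A * transpose_mat A) *\<^sub>v y)"
    using scalar_prod_gram[OF AT y y] by (simp add: z_def)
  also have "\<dots> = y \<bullet> y + y \<bullet> ((A * transpose_mat A - 1\<^sub>m m) *\<^sub>v y)"
    using AAT y by (simp add: minus_mult_distrib_mat_vec[of _ m m] scalar_prod_minus_distrib[of _ m])
  also have "\<dots> \<le> (1 + \<delta>) * (y \<bullet> y)"
  proof -
    have "\<bar>y \<bullet> ((A * transpose_mat A - 1\<^sub>m m) *\<^sub>v y)\<bar> \<le> \<delta> * (y \<bullet> y)"
      using P1 A y AAT unfolding property_P1_def by (intro abs_quadratic_form_le[of _ m]) auto
    then show ?thesis by (simp add: algebra_simps)
  qed
  finally have zz: "z \<bullet> z \<le> (1 + \<delta>) * (y \<bullet> y)" .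
  have "y \<bullet> y = z \<bullet> x" unfolding z_def using transpose_vec_mult_scalar[OF A x y] by (simp add: y_def)
  then have "(y \<bullet> y)\<^sup>2 \<le> (vec_norm2 z * vec_norm2 x)\<^sup>2"
    using abs_scalar_prod_le[of z x] z x
    by (intro abs_le_square_iff[THEN iffD1]) (simp add: vec_norm2_nonneg)
  also have "\<dots> = (z \<bullet> z) * (x \<bullet> x)" by (simp add: power_mult_distrib vec_norm2_power2)
  also have "\<dots> \<le> (1 + \<delta>) * (y \<bullet> y) * (x \<bullet> x)"
    using zz scalar_prod_self_nonneg by (rule mult_right_mono)
  finally have "(y \<bullet> y) * (y \<bullet> y) \<le> (y \<bullet> y) * ((1 + \<delta>) * (x \<bullet> x))"
    by (simp add: power2_eq_square mult_ac)
  \<comment> \<open>Cancel the factor \<open>y \<bullet> y\<close>; if it vanishes, the claim is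
    that the right-hand side is nonnegative.\<close>
  then have "y \<bullet> y \<le> (1 + \<delta>) * (x \<bullet> x)"
    using scalar_prod_self_nonneg[of y] scalar_prod_self_nonneg[of x] \<open>0 \<le> \<delta>\<close>
    by (cases "y \<bullet> y = 0") auto
  then show ?thesis by (simp add: y_def)
qed

text \<open>Makes the case of exactly orthonormal rows the instance \<delta> = 0 of the case
  P1.\<close>

lemma property_P1_orthonormal:
  assumes A: "A \<in> carrier_mat m n" and "A * transpose_mat A = 1\<^sub>m m"
  shows "property_P1 A 0"
proof -
  have "spectral_norm (1\<^sub>m m - 1\<^sub>m m) \<le> 0"
    unfolding spectral_norm_def
  proof (rule cSUP_least)
    show "{v \<in> carrier_vec (dim_col (1\<^sub>m m - 1\<^sub>m m :: real mat)). vec_norm2 v \<le> 1} \<noteq> {}"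
      by (auto intro!: exI[of _ "0\<^sub>v m"] simp: vec_norm2_def)
  next
    fix v assume "v \<in> {v \<in> carrier_vec (dim_col (1\<^sub>m m - 1\<^sub>m m :: real mat)). vec_norm2 v \<le> 1}"
    then have "(1\<^sub>m m - 1\<^sub>m m) *\<^sub>v v = 0\<^sub>v m"
      by (auto simp: minus_mult_distrib_mat_vec[of _ m m])
    then show "vec_norm2 ((1\<^sub>m m - 1\<^sub>m m) *\<^sub>v v) \<le> 0" by (simp add: vec_norm2_def)
  qed
  then show ?thesis using assms unfolding property_P1_def by simp
qed

text \<open>A vector supported on \<open>S\<close> involves only the columns of \<open>A\<close>
  indexed by \<open>S\<close>. P2 for the submatrix \<open>B\<close> of these columns bounds the
  quadratic form of \<open>n/m\<close> times the Gram matrix minus the identity; multiplication by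
  \<open>m/n\<close> gives the claim.\<close>

lemma property_P2_quadratic_form:
  assumes A: "A \<in> carrier_mat m n" and "0 < m" and "0 < n" and P2: "property_P2 A (card S) \<delta>"
    and S: "S \<subseteq> {..<n}" and x: "x \<in> carrier_vec n" and supp: "\<And>j. j < n \<Longrightarrow> j \<notin> S \<Longrightarrow> x $ j = 0"
  shows "\<bar>(A *\<^sub>v x) \<bullet> (A *\<^sub>v x) - real m / real n * (x \<bullet> x)\<bar> \<le> real m / real n * \<delta> * (x \<bullet> x)"
proof -
  have fin: "finite S" using S finite_subset by blast
  define js where "js = sorted_list_of_set S"
  have js: "distinct js" "set js = S" "length js = card S" using fin by (auto simp: js_def)
  let ?l = "card S"
  define B where "B = mat_of_cols (dim_row A) (map (col A) js)"
  \<comment> \<open>The entries of \<open>x\<close> on \<open>S\<close>, in the order of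
    \<open>js\<close>. Dropping the zeros of \<open>x\<close> changes neither its length nor its
    image, so \<open>y \<bullet> y = x \<bullet> x\<close> and \<open>B\<close> maps
    \<open>y\<close> to the image of \<open>x\<close>.\<close>
  define y where "y = vec ?l (\<lambda>k. x $ (js ! k))"
  have B: "B \<in> carrier_mat m ?l" using A js by (simp add: B_def mat_of_cols_def)
  have y: "y \<in> carrier_vec ?l" by (simp add: y_def)
  have bij: "bij_betw ((!) js) {0..<?l} S"
    using bij_betw_nth[OF js(1) _ refl] js by (simp add: atLeast0LessThan)
  have sumS: "(\<Sum>k = 0..<?l. f (js ! k)) = (\<Sum>j = 0..<n. f j)" if "\<And>j. j < n \<Longrightarrow> j \<notin> S \<Longrightarrow> f j = 0"
    for f :: "nat \<Rightarrow> real"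
  proof -
    have "(\<Sum>k = 0..<?l. f (js ! k)) = sum f S" by (rule sum.reindex_bij_betw[OF bij])
    also have "\<dots> = (\<Sum>j = 0..<n. f j)" using S that by (intro sum.mono_neutral_left) auto
    finally show ?thesis .
  qed
  have nth_less: "js ! k < n" if "k < ?l" for k
    using that S js by (metis lessThan_iff nth_mem subsetD)
  have yy: "y \<bullet> y = x \<bullet> x"
    using sumS[of "\<lambda>j. x $ j * x $ j"] supp x by (simp add: scalar_prod_def y_def)
  have By: "B *\<^sub>v y = A *\<^sub>v x"
  proof (rule eq_vecI)
    fix i assume "i < dim_vec (A *\<^sub>v x)"
    then have i: "i < m" using A by simp
    have "(B *\<^sub>v y) $ i = (\<Sum>k = 0..<?l. A $$ (i, js ! k) * x $ (js ! k))"
      using i A B js nth_less by (simp add: scalar_prod_def y_def B_def mat_of_cols_def)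
    also have "\<dots> = (A *\<^sub>v x) $ i"
      using i A x supp by (subst sumS) (auto simp: scalar_prod_def)
    finally show "(B *\<^sub>v y) $ i = (A *\<^sub>v x) $ i" .
  qed (use A B in auto)
  let ?r = "real n / real m"
  let ?M = "?r \<cdot>\<^sub>m (transpose_mat B * B) - 1\<^sub>m ?l"
  have BB: "transpose_mat B * B \<in> carrier_mat ?l ?l" using B by simp
  have "spectral_norm ?M \<le> \<delta>"
    using P2 A S js unfolding property_P2_def by (auto simp: B_def Let_def)
  then have "\<bar>y \<bullet> (?M *\<^sub>v y)\<bar> \<le> \<delta> * (y \<bullet> y)"
    using B by (intro abs_quadratic_form_le[OF _ y]) auto
  moreover have "y \<bullet> (?M *\<^sub>v y) = ?r * ((A *\<^sub>v x) \<bullet> (A *\<^sub>v x)) - x \<bullet> x"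
  proof -
    have rBB: "?r \<cdot>\<^sub>m (transpose_mat B * B) \<in> carrier_mat ?l ?l" using BB by simp
    have "y \<bullet> (?M *\<^sub>v y) = y \<bullet> ((?r \<cdot>\<^sub>m (transpose_mat B * B)) *\<^sub>v y) - y \<bullet> y"
      using scalar_prod_minus_distrib[OF y mult_mat_vec_carrier[OF rBB y] y] y
      by (simp only: minus_mult_distrib_mat_vec[OF rBB one_carrier_mat y] one_mult_mat_vec[OF y])
    also have "(?r \<cdot>\<^sub>m (transpose_mat B * B)) *\<^sub>v y = ?r \<cdot>\<^sub>v ((transpose_mat B * B) *\<^sub>v y)"
      using BB y by (intro eq_vecI) auto
    also have "y \<bullet> \<dots> = ?r * (y \<bullet> ((transpose_mat B * B) *\<^sub>v y))"
      using BB y B by simp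
    also have "\<dots> = ?r * ((A *\<^sub>v x) \<bullet> (A *\<^sub>v x))" using scalar_prod_gram[OF B y y] By by simp
    finally show ?thesis by (simp add: yy)
  qed
  ultimately have "real m / real n * \<bar>?r * ((A *\<^sub>v x) \<bullet> (A *\<^sub>v x)) - x \<bullet> x\<bar> \<le> real m / real n * (\<delta> * (x \<bullet> x))"
    by (intro mult_left_mono) (simp_all add: yy)
  also have "real m / real n * \<bar>?r * ((A *\<^sub>v x) \<bullet> (A *\<^sub>v x)) - x \<bullet> x\<bar>
      = \<bar>real m / real n * (?r * ((A *\<^sub>v x) \<bullet> (A *\<^sub>v x)) - x \<bullet> x)\<bar>"
    by (simp add: abs_mult)
  also have "real m / real n * (?r * ((A *\<^sub>v x) \<bullet> (A *\<^sub>v x)) - x \<bullet> x)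
      = (A *\<^sub>v x) \<bullet> (A *\<^sub>v x) - real m / real n * (x \<bullet> x)"
    using \<open>0 < m\<close> \<open>0 < n\<close> by (simp add: right_diff_distrib)
  finally show ?thesis by (simp add: mult.assoc)
qed

text \<open>
  Orthogonality saves a factor 2 over the Cauchy--Schwarz inequality:
  compare the norms of \<open>A (\<bar>y\<bar> x \<plusminus> \<bar>x\<bar> y)\<close> and \<open>\<bar>y\<bar> x \<plusminus> \<bar>x\<bar> y\<close>.
\<close>

lemma scalar_prod_image_orthogonal_le:
  assumes A: "A \<in> carrier_mat m n" and x: "x \<in> carrier_vec n" and y: "y \<in> carrier_vec n"
    and M: "\<And>z. z \<in> carrier_vec n \<Longrightarrow> (A *\<^sub>v z) \<bullet> (A *\<^sub>v z) \<le> M * (z \<bullet> z)"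
    and orth: "x \<bullet> y = 0"
  shows "2 * \<bar>(A *\<^sub>v x) \<bullet> (A *\<^sub>v y)\<bar> \<le> M * (vec_norm2 x * vec_norm2 y)"
proof -
  let ?a = "vec_norm2 x" and ?b = "vec_norm2 y"
  define X where "X = A *\<^sub>v x"
  define Y where "Y = A *\<^sub>v y"
  have X: "X \<in> carrier_vec m" and Y: "Y \<in> carrier_vec m" using A x y by (auto simp: X_def Y_def)
  define q where "q t s = t\<^sup>2 * (X \<bullet> X) + s\<^sup>2 * (Y \<bullet> Y) + 2 * t * s * (X \<bullet> Y)" for t s
  have q: "0 \<le> q t s" "q t s \<le> M * (t\<^sup>2 * (x \<bullet> x) + s\<^sup>2 * (y \<bullet> y))" for t s
  proof -
    have exp: "(t \<cdot>\<^sub>v v + s \<cdot>\<^sub>v w) \<bullet> (t \<cdot>\<^sub>v v + s \<cdot>\<^sub>v w)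
        = t\<^sup>2 * (v \<bullet> v) + s\<^sup>2 * (w \<bullet> w) + 2 * t * s * (v \<bullet> w)"
      if v: "v \<in> carrier_vec k" and w: "w \<in> carrier_vec k" for v w :: "real vec" and k
      using v w comm_scalar_prod[OF w v]
      by (simp add: add_scalar_prod_distrib[of _ k] scalar_prod_add_distrib[of _ k]
          power2_eq_square algebra_simps)
    have "A *\<^sub>v (t \<cdot>\<^sub>v x + s \<cdot>\<^sub>v y) = t \<cdot>\<^sub>v X + s \<cdot>\<^sub>v Y"
      using A x y by (simp add: mult_add_distrib_mat_vec[of _ m n] mult_mat_vec[of _ m n] X_def Y_def)
    with M[of "t \<cdot>\<^sub>v x + s \<cdot>\<^sub>v y"] show "q t s \<le> M * (t\<^sup>2 * (x \<bullet> x) + s\<^sup>2 * (y \<bullet> y))"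
      using x y exp[OF x y] exp[OF X Y] orth by (simp add: q_def)
    show "0 \<le> q t s" using scalar_prod_self_nonneg[of "t \<cdot>\<^sub>v X + s \<cdot>\<^sub>v Y"] exp[OF X Y] by (simp add: q_def)
  qed
  \<comment> \<open>The left-hand side is \<open>q t s - q t (- s)\<close>, and the subtracted term
    is nonnegative.\<close>
  have bound: "4 * t * s * (X \<bullet> Y) \<le> M * (t\<^sup>2 * ?a\<^sup>2 + s\<^sup>2 * ?b\<^sup>2)" for t s
    using q(1)[of t "- s"] q(2)[of t s] by (simp add: q_def vec_norm2_power2)
  show ?thesis
  proof (cases "?a = 0 \<or> ?b = 0")
    case True
    moreover have "X = 0\<^sub>v m" if "?a = 0"
      using that x A scalar_prod_self_pos[OF x] vec_norm2_power2[of x] by (force simp: X_def)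
    moreover have "Y = 0\<^sub>v m" if "?b = 0"
      using that y A scalar_prod_self_pos[OF y] vec_norm2_power2[of y] by (force simp: Y_def)
    ultimately show ?thesis using X Y unfolding X_def[symmetric] Y_def[symmetric] by auto
  next
    case False
    then have pos: "0 < ?a * ?b" using vec_norm2_nonneg[of x] vec_norm2_nonneg[of y] by simp
    \<comment> \<open>With the weights \<open>t = ?b\<close> and \<open>s = ?a\<close> or
      \<open>s = - ?a\<close>, both squares on the right of \<open>bound\<close> equal
      \<open>(?a * ?b)\<^sup>2\<close>; the two signs give the absolute value.\<close>
    have "(?a * ?b) * (2 * \<bar>X \<bullet> Y\<bar>) \<le> (?a * ?b) * (M * (?a * ?b))"
      using bound[of ?b ?a] bound[of ?b "- ?a"] by (simp add: abs_if power2_eq_square algebra_simps)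
    then show ?thesis using pos unfolding X_def Y_def by (simp only: mult_le_cancel_left_pos)
  qed
qed

section \<open>Inverses and diagonal matrices\<close>

lemma invertible_matI_right_inverse:
  assumes "(M :: real mat) \<in> carrier_mat n n" and "N \<in> carrier_mat n n" and "M * N = 1\<^sub>m n"
  shows "invertible_mat M"
  using assms mat_mult_left_right_inverse[OF assms]
  unfolding invertible_mat_def inverts_mat_def by auto

lemma mat_inv_eqI:
  assumes M: "M \<in> carrier_mat n n" and N: "N \<in> carrier_mat n n" and MN: "M * N = 1\<^sub>m n"
  shows "mat_inv M = N"
proof (cases "mat_inverse M")
  case None
  \<comment> \<open>\<open>mat_inverse\<close> returns \<open>None\<close> only for matrices that
    are not units, which the two-sided inverse \<open>N\<close> rules out.\<close>
  have "N * M = 1\<^sub>m n" using mat_mult_left_right_inverse[OF M N MN] .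
  then have "M \<in> Units (ring_mat TYPE(real) n ())"
    using M N MN unfolding Units_def ring_mat_def by auto
  with mat_inverse(1)[OF M None, where b = "()"] show ?thesis by blast
next
  case (Some K)
  from mat_inverse(2)[OF M Some] have K: "K * M = 1\<^sub>m n" "K \<in> carrier_mat n n" by auto
  have "K = K * (M * N)" using K MN by simp
  also have "\<dots> = N" using K M N by (simp add: assoc_mult_mat[symmetric])
  finally show ?thesis using Some by (simp add: mat_inv_def)
qed

lemma mat_inv_mat_diag:
  assumes "\<And>i. i < n \<Longrightarrow> f i \<noteq> 0"
  shows "mat_inv (mat_diag n f) = mat_diag n (\<lambda>i. inverse (f i))"
proof (rule mat_inv_eqI)
  show "mat_diag n f * mat_diag n (\<lambda>i. inverse (f i)) = 1\<^sub>m n"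
    using assms by (intro eq_matI) (auto simp: mat_diag_diag, auto simp: mat_diag_def)
qed auto

lemma pos_diag_mat_obtain:
  assumes "pos_diag_mat n D"
  obtains f where "D = mat_diag n f" and "\<And>i. 0 < f i"
proof
  \<comment> \<open>The value 1 outside the matrix makes \<open>?f\<close> positive at every index,
    so later arguments carry no range condition.\<close>
  let ?f = "\<lambda>i. if i < n then D $$ (i, i) else 1"
  show "D = mat_diag n ?f"
    using assms unfolding pos_diag_mat_def diagonal_mat_def mat_diag_def by (intro eq_matI) auto
  show "0 < ?f i" for i using assms by (simp add: pos_diag_mat_def)
qed

section \<open>Spectrum of the preconditioned block matrix\<close>

text \<open>The characteristic matrix inherits the zero block, so its determinant is the product of
  those of the diagonal blocks.\<close>

lemma char_poly_four_block_upper_right_zero: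
  fixes M :: "'a :: idom mat"
  assumes M: "M \<in> carrier_mat n n" and N: "N \<in> carrier_mat k n" and K: "K \<in> carrier_mat k k"
  shows "char_poly (four_block_mat M (0\<^sub>m n k) N K) = char_poly M * char_poly K"
proof -
  have "char_poly_matrix (four_block_mat M (0\<^sub>m n k) N K)
      = four_block_mat (char_poly_matrix M) (0\<^sub>m n k) (map_mat (\<lambda>a. [:- a:]) N) (char_poly_matrix K)"
    using assms by (intro eq_matI) (auto simp: char_poly_matrix_def)
  then show ?thesis
    unfolding char_poly_def using assms
    by (simp add: det_four_block_mat_upper_right_zero[OF _ refl, of _ n _ k])
qed

lemma char_poly_one_mat: "char_poly (1\<^sub>m n :: 'a :: comm_ring_1 mat) = [:-1, 1:] ^ n"
proof -
  have "diag_mat (1\<^sub>m n :: 'a mat) = replicate n 1"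
    by (auto simp: diag_mat_def list_eq_iff_nth_eq)
  then show ?thesis
    by (subst char_poly_upper_triangular[of _ n]) auto
qed

text \<open>The characteristic polynomial is factored over the reals and the factorization is
  carried over to the complex numbers. Since the factors are nonzero, the multiset of roots of the
  product is the sum of the multisets of roots.\<close>

lemma eigenvalues_mset_similar_block:
  assumes W: "W \<in> carrier_mat n n" and X: "X \<in> carrier_mat k n"
    and sim: "similar_mat N (four_block_mat W (0\<^sub>m n k) X (1\<^sub>m k))"
  shows "eigenvalues_mset N = replicate_mset k 1 + eigenvalues_mset W"
proof -
  let ?T = "four_block_mat W (0\<^sub>m n k) X (1\<^sub>m k)"
  interpret c: map_poly_comm_ring_hom complex_of_real ..
  have T: "?T \<in> carrier_mat (n + k) (n + k)" using W by simp
  have N: "N \<in> carrier_mat (n + k) (n + k)"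
  proof -
    obtain n' where "N \<in> carrier_mat n' n'" "?T \<in> carrier_mat n' n'"
      using similar_matD[OF sim] by blast
    with T show ?thesis using carrier_matD(1) by metis
  qed
  have "char_poly N = char_poly W * [:-1, 1:] ^ k"
    using char_poly_similar[OF sim] char_poly_four_block_upper_right_zero[OF W X, of "1\<^sub>m k"]
    by (simp add: char_poly_one_mat)
  then have "char_poly (map_mat complex_of_real N) = char_poly (map_mat complex_of_real W) * [:-1, 1:] ^ k"
    by (simp add: of_real_hom.char_poly_hom[OF N] of_real_hom.char_poly_hom[OF W]
        c.hom_mult c.hom_power of_real_hom.map_poly_pCons_hom)
  moreover have "char_poly (map_mat complex_of_real W) \<noteq> 0"
    using degree_monic_char_poly[of "map_mat complex_of_real W" n] W by auto
  ultimately show ?thesis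
    by (simp add: eigenvalues_mset_def proots_mult proots_power)
qed

text \<open>In each block row of the first matrix the two blocks add up to the identity, so it fixes
  every vector \<open>(x, x)\<close>. In the coordinates given by \<open>?S\<close>, namely the
  difference of the two halves and the second half, these vectors are those with first half zero,
  whence the second block column of the triangular matrix.\<close>

lemma similar_mat_difference_coordinates:
  assumes W: "(W :: 'a :: comm_ring_1 mat) \<in> carrier_mat n n" and X: "X \<in> carrier_mat n n"
  shows "similar_mat (four_block_mat (W + X) (1\<^sub>m n - (W + X)) X (1\<^sub>m n - X))
    (four_block_mat W (0\<^sub>m n n) X (1\<^sub>m n))"
proof (rule similar_matI)
  let ?S = "four_block_mat (1\<^sub>m n) (- 1\<^sub>m n) (0\<^sub>m n n) (1\<^sub>m n :: 'a mat)"
  let ?R = "four_block_mat (1\<^sub>m n) (1\<^sub>m n) (0\<^sub>m n n) (1\<^sub>m n :: 'a mat)"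
  have zero: "1\<^sub>m n + - 1\<^sub>m n = (0\<^sub>m n n :: 'a mat)" "- 1\<^sub>m n + 1\<^sub>m n = (0\<^sub>m n n :: 'a mat)"
    "- 0\<^sub>m n n + 1\<^sub>m n = (1\<^sub>m n :: 'a mat)"
    by (auto intro!: eq_matI)
  show "?R * ?S = 1\<^sub>m (n + n)" "?S * ?R = 1\<^sub>m (n + n)"
    by (subst mult_four_block_mat[of _ n n _ n _ n _ _ n _ n]; simp add: zero)+
  have neg: "V * - 1\<^sub>m n + 1\<^sub>m n = 1\<^sub>m n - V" if V: "V \<in> carrier_mat n n" for V :: "'a mat"
    using V by (intro eq_matI) auto
  have "?R * four_block_mat W (0\<^sub>m n n) X (1\<^sub>m n) = four_block_mat (W + X) (1\<^sub>m n) X (1\<^sub>m n)"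
    using W X by (subst mult_four_block_mat[of _ n n _ n _ n _ _ n _ n]) auto
  moreover have "four_block_mat (W + X) (1\<^sub>m n) X (1\<^sub>m n) * ?S
      = four_block_mat (W + X) (1\<^sub>m n - (W + X)) X (1\<^sub>m n - X)"
    using W X by (subst mult_four_block_mat[of _ n n _ n _ n _ _ n _ n]) (auto simp: neg)
  ultimately show "four_block_mat (W + X) (1\<^sub>m n - (W + X)) X (1\<^sub>m n - X)
    = ?R * four_block_mat W (0\<^sub>m n n) X (1\<^sub>m n) * ?S" by simp
qed (use W X in auto)

text \<open>The terms with \<open>G\<close> and with \<rho> vanish on vectors \<open>(x, x)\<close>,
  so there the two block matrices agree and the preconditioned matrix acts as the identity. Here
  \<open>d\<close>, \<open>e\<close> and \<open>f\<close> stand for the diagonals of the inverses of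
  \<open>\<Theta>u\<close>, \<open>\<Theta>v\<close> and their sum.\<close>

lemma preconditioned_block_spectrum:
  fixes d e :: "nat \<Rightarrow> real" and \<rho> :: real
  assumes d: "\<And>i. 0 < d i" and e: "\<And>i. 0 < e i" and \<rho>: "0 \<le> \<rho>" and G: "G \<in> carrier_mat n n"
  defines "f \<equiv> \<lambda>i. inverse (inverse (d i) + inverse (e i))"
  defines "P \<equiv> four_block_mat (mat_diag n (\<lambda>i. d i + \<rho>)) (mat_diag n (\<lambda>i. - \<rho>))
      (mat_diag n (\<lambda>i. - \<rho>)) (mat_diag n (\<lambda>i. e i + \<rho>))"
  shows "invertible_mat P"
    and "eigenvalues_mset (mat_inv P * four_block_mat (mat_diag n d + G) (- G) (- G) (mat_diag n e + G))
      = replicate_mset n 1 + eigenvalues_mset (mat_inv (mat_diag n (\<lambda>i. f i + \<rho>)) * (mat_diag n f + G))"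
proof -
  \<comment> \<open>\<open>P\<close> decouples into 2 by 2 matrices, one for each index
    \<open>i\<close>. Their determinant
    \<open>(d i + \<rho>) * (e i + \<rho>) - \<rho>\<^sup>2\<close> is \<open>\<Delta> i\<close>,
    and \<open>a\<close>, \<open>b\<close>, \<open>c\<close> are the entries of their
    inverses.\<close>
  define \<Delta> where "\<Delta> i = d i * e i + \<rho> * (d i + e i)" for i
  have \<Delta>: "0 < \<Delta> i" for i using d[of i] e[of i] \<rho> by (simp add: \<Delta>_def add_pos_nonneg)
  have [simp]: "\<Delta> i \<noteq> 0" for i using \<Delta>[of i] by simp
  define a where "a i = (e i + \<rho>) / \<Delta> i" for i
  define b where "b i = \<rho> / \<Delta> i" for i
  define c where "c i = (d i + \<rho>) / \<Delta> i" for i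
  let ?D = "mat_diag n :: (nat \<Rightarrow> real) \<Rightarrow> real mat"
  let ?N = "four_block_mat (?D a) (?D b) (?D b) (?D c)"
  have D_add: "?D g + ?D h = ?D (\<lambda>i. g i + h i)" for g h
    by (intro eq_matI) (auto simp: mat_diag_def)
  have D_zero: "?D (\<lambda>i. 0) = 0\<^sub>m n n" by (intro eq_matI) (auto simp: mat_diag_def)
  have inv: "(d i + \<rho>) * a i - \<rho> * b i = 1" "(d i + \<rho>) * b i - \<rho> * c i = 0"
    "(e i + \<rho>) * b i - \<rho> * a i = 0" "(e i + \<rho>) * c i - \<rho> * b i = 1" for i
    using \<Delta>[of i]
    by (simp_all add: a_def b_def c_def divide_simps) (simp_all add: \<Delta>_def algebra_simps)
  have P: "P \<in> carrier_mat (n + n) (n + n)" and N: "?N \<in> carrier_mat (n + n) (n + n)"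
    unfolding P_def by auto
  have PN: "P * ?N = 1\<^sub>m (n + n)"
    unfolding P_def using inv
    by (subst mult_four_block_mat[of _ n n _ n _ n _ _ n _ n]) (auto simp: D_add D_zero mult.commute)
  show "invertible_mat P" using invertible_matI_right_inverse[OF P N PN] .
  \<comment> \<open>\<open>?W\<close> is the reduced preconditioned matrix, written out by means of
    \<open>f i = d i * e i / (d i + e i)\<close> and
    \<open>f i + \<rho> = \<Delta> i / (d i + e i)\<close>; \<open>?X\<close> is the lower left
    block of the full one.\<close>
  let ?W = "mat n n (\<lambda>(i, j). (if i = j then d i * e i / \<Delta> i else 0) + (d i + e i) / \<Delta> i * G $$ (i, j))"
  let ?X = "mat n n (\<lambda>(i, j). (if i = j then b i * d i else 0) + (b i - c i) * G $$ (i, j))"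
  have f: "inverse (f i + \<rho>) = (d i + e i) / \<Delta> i" "(d i / \<Delta> i + e i / \<Delta> i) * f i = d i * e i / \<Delta> i" for i
  proof -
    have pos: "0 < d i" "0 < e i" "0 < d i + e i" using d[of i] e[of i] by auto
    have fi: "f i = d i * e i / (d i + e i)" using pos by (simp add: f_def field_simps)
    have "f i + \<rho> = \<Delta> i / (d i + e i)" using pos by (simp add: fi \<Delta>_def field_simps)
    then show "inverse (f i + \<rho>) = (d i + e i) / \<Delta> i" by simp
    show "(d i / \<Delta> i + e i / \<Delta> i) * f i = d i * e i / \<Delta> i"
      using pos by (simp add: fi add_divide_distrib[symmetric])
  qed
  have "f i + \<rho> \<noteq> 0" for i
    using d[of i] e[of i] \<rho> by (simp add: f_def add_pos_nonneg less_imp_neq[THEN not_sym])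
  then have W: "mat_inv (?D (\<lambda>i. f i + \<rho>)) * (?D f + G) = ?W"
    using G by (subst mat_inv_mat_diag, simp, subst mat_diag_mult_left[of _ n n])
      (auto intro!: eq_matI simp: f distrib_left add_divide_distrib mat_diag_def)
  have "mat_inv P * four_block_mat (?D d + G) (- G) (- G) (?D e + G)
      = ?N * four_block_mat (?D d + G) (- G) (- G) (?D e + G)"
    using mat_inv_eqI[OF P N PN] by simp
  also have "\<dots> = four_block_mat (?D a * (?D d + G) + ?D b * - G) (?D a * - G + ?D b * (?D e + G))
      (?D b * (?D d + G) + ?D c * - G) (?D b * - G + ?D c * (?D e + G))"
    using G by (intro mult_four_block_mat[of _ n n _ n _ n _ _ n _ n]) auto
  also have "\<dots> = four_block_mat (?W + ?X) (1\<^sub>m n - (?W + ?X)) ?X (1\<^sub>m n - ?X)"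
  proof (rule arg_cong4[of _ _ _ _ _ _ _ _ four_block_mat])
    have left: "?D g * (?D h + G) + ?D k * - G
        = mat n n (\<lambda>(i, j). (if i = j then g i * h i else 0) + (g i - k i) * G $$ (i, j))" for g h k
      using G by (simp add: mat_diag_mult_left[of _ n n])
        (auto intro!: eq_matI simp: mat_diag_def algebra_simps)
    have right: "?D k * - G + ?D g * (?D h + G) = ?D g * (?D h + G) + ?D k * - G" for g h k
      using G by (intro comm_add_mat[of _ n n] mult_carrier_mat[of _ n n]) auto
    \<comment> \<open>The first two identities produce the upper left block, the next two the upper
      right block and the last two the lower right block.\<close>
    have coef: "a i * d i = d i * e i / \<Delta> i + b i * d i"
      "a i - b i = (d i + e i) / \<Delta> i + (b i - c i)"
      "b i - a i = - ((d i + e i) / \<Delta> i + (b i - c i))"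
      "b i * e i = 1 - (d i * e i / \<Delta> i + b i * d i)"
      "c i * e i = 1 - b i * d i" "c i - b i = - (b i - c i)" for i
      by (simp_all add: a_def b_def c_def divide_simps) (simp_all add: \<Delta>_def algebra_simps)
    show "?D a * (?D d + G) + ?D b * - G = ?W + ?X"
      unfolding left coef by (intro eq_matI) (auto simp: algebra_simps)
    show "?D a * - G + ?D b * (?D e + G) = 1\<^sub>m n - (?W + ?X)"
      unfolding right left coef by (intro eq_matI) (auto simp: algebra_simps)
    show "?D b * (?D d + G) + ?D c * - G = ?X"
      unfolding left ..
    show "?D b * - G + ?D c * (?D e + G) = 1\<^sub>m n - ?X"
      unfolding right left coef(5,6) by (intro eq_matI) (auto simp: algebra_simps)
  qed
  finally show "eigenvalues_mset (mat_inv P * four_block_mat (?D d + G) (- G) (- G) (?D e + G))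
      = replicate_mset n 1 + eigenvalues_mset (mat_inv (?D (\<lambda>i. f i + \<rho>)) * (?D f + G))"
    unfolding W using similar_mat_difference_coordinates[of ?W n ?X]
    by (intro eigenvalues_mset_similar_block[of _ _ ?X]) auto
qed

section \<open>Real eigenvalues of symmetric definite pencils\<close>

lemma symmetric_scalar_prod_mult_mat_vec:
  fixes M :: "'a :: comm_semiring_0 mat"
  assumes M: "M \<in> carrier_mat n n" "transpose_mat M = M"
    and x: "x \<in> carrier_vec n" and y: "y \<in> carrier_vec n"
  shows "x \<bullet> (M *\<^sub>v y) = y \<bullet> (M *\<^sub>v x)"
  using transpose_vec_mult_scalar[OF M(1) y x] M x y comm_scalar_prod[of "M *\<^sub>v x" n y] by simp

text \<open>
  For an eigenvector \<open>p + \<i> q\<close> with eigenvalue \<open>s + \<i> t\<close>, comparing \<open>p\<^sup>T H q\<close> with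
  \<open>q\<^sup>T H p\<close> gives \<open>t (p\<^sup>T P p + q\<^sup>T P q) = 0\<close>.
\<close>

lemma symmetric_definite_pencil_real_eigenvalue:
  fixes H P N :: "real mat"
  assumes H: "H \<in> carrier_mat n n" "transpose_mat H = H"
    and P: "P \<in> carrier_mat n n" "transpose_mat P = P"
    and pos: "\<And>x. x \<in> carrier_vec n \<Longrightarrow> x \<noteq> 0\<^sub>v n \<Longrightarrow> 0 < x \<bullet> (P *\<^sub>v x)"
    and N: "N \<in> carrier_mat n n" and PN: "P * N = H"
    and ev: "eigenvalue (map_mat complex_of_real N) \<mu>"
  obtains s x where "\<mu> = complex_of_real s" "x \<in> carrier_vec n" "x \<noteq> 0\<^sub>v n" "H *\<^sub>v x = s \<cdot>\<^sub>v (P *\<^sub>v x)"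
proof -
  obtain z where z: "z \<in> carrier_vec n" "z \<noteq> 0\<^sub>v n" "map_mat complex_of_real N *\<^sub>v z = \<mu> \<cdot>\<^sub>v z"
    using ev N unfolding eigenvalue_def eigenvector_def by auto
  define p where "p = map_vec Re z"
  define q where "q = map_vec Im z"
  let ?s = "Re \<mu>" and ?t = "Im \<mu>"
  have p: "p \<in> carrier_vec n" and q: "q \<in> carrier_vec n" using z by (auto simp: p_def q_def)
  have entry: "(\<Sum>j = 0..<n. complex_of_real (N $$ (i, j)) * z $ j) = \<mu> * z $ i" if "i < n" for i
    using arg_cong[OF z(3), of "\<lambda>w. w $ i"] that N z(1) by (simp add: scalar_prod_def)
  \<comment> \<open>Real and imaginary parts of the eigenvalue equation, using that \<open>N\<close>
    is real.\<close>
  have "N *\<^sub>v p = ?s \<cdot>\<^sub>v p + (- ?t) \<cdot>\<^sub>v q"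
  proof (rule eq_vecI)
    fix i assume "i < dim_vec (?s \<cdot>\<^sub>v p + (- ?t) \<cdot>\<^sub>v q)"
    then have i: "i < n" using q by simp
    then show "(N *\<^sub>v p) $ i = (?s \<cdot>\<^sub>v p + (- ?t) \<cdot>\<^sub>v q) $ i"
      using arg_cong[OF entry[OF i], of Re] N z(1) by (simp add: scalar_prod_def p_def q_def)
  qed (use N q in auto)
  moreover have "N *\<^sub>v q = ?s \<cdot>\<^sub>v q + ?t \<cdot>\<^sub>v p"
  proof (rule eq_vecI)
    fix i assume "i < dim_vec (?s \<cdot>\<^sub>v q + ?t \<cdot>\<^sub>v p)"
    then have i: "i < n" using p by simp
    then show "(N *\<^sub>v q) $ i = (?s \<cdot>\<^sub>v q + ?t \<cdot>\<^sub>v p) $ i"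
      using arg_cong[OF entry[OF i], of Im] N z(1) by (simp add: scalar_prod_def p_def q_def)
  qed (use N p in auto)
  moreover have "P *\<^sub>v (a \<cdot>\<^sub>v v + b \<cdot>\<^sub>v w) = a \<cdot>\<^sub>v (P *\<^sub>v v) + b \<cdot>\<^sub>v (P *\<^sub>v w)"
    if "v \<in> carrier_vec n" "w \<in> carrier_vec n" for a b v w
    using P that by (simp add: mult_add_distrib_mat_vec[of _ n n] mult_mat_vec[of _ n n])
  ultimately have Hp: "H *\<^sub>v p = ?s \<cdot>\<^sub>v (P *\<^sub>v p) + (- ?t) \<cdot>\<^sub>v (P *\<^sub>v q)"
    and Hq: "H *\<^sub>v q = ?s \<cdot>\<^sub>v (P *\<^sub>v q) + ?t \<cdot>\<^sub>v (P *\<^sub>v p)"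
    using P N p q unfolding PN[symmetric] by (simp_all add: assoc_mult_mat_vec[of _ n n _ n])
  have Pp: "P *\<^sub>v p \<in> carrier_vec n" and Pq: "P *\<^sub>v q \<in> carrier_vec n" using P p q by auto
  have "q \<bullet> (H *\<^sub>v p) = ?s * (q \<bullet> (P *\<^sub>v p)) - ?t * (q \<bullet> (P *\<^sub>v q))"
    using q Pp Pq unfolding Hp by (simp add: scalar_prod_add_distrib[of _ n])
  moreover have "p \<bullet> (H *\<^sub>v q) = ?s * (p \<bullet> (P *\<^sub>v q)) + ?t * (p \<bullet> (P *\<^sub>v p))"
    using p Pp Pq unfolding Hq by (simp add: scalar_prod_add_distrib[of _ n])
  ultimately have t0: "?t * (p \<bullet> (P *\<^sub>v p) + q \<bullet> (P *\<^sub>v q)) = 0"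
    using symmetric_scalar_prod_mult_mat_vec[OF H p q] symmetric_scalar_prod_mult_mat_vec[OF P p q]
    by (simp add: algebra_simps)
  have nz: "p \<noteq> 0\<^sub>v n \<or> q \<noteq> 0\<^sub>v n"
  proof (rule ccontr)
    assume "\<not> ?thesis"
    then have "z $ i = 0" if "i < n" for i
      using that z(1) by (auto simp: p_def q_def complex_eq_iff vec_eq_iff)
    then have "z = 0\<^sub>v n" using z(1) by (intro eq_vecI) auto
    with z(2) show False ..
  qed
  have nonneg: "0 \<le> x \<bullet> (P *\<^sub>v x)" if "x \<in> carrier_vec n" for x
    using pos[OF that] P by (cases "x = 0\<^sub>v n") (auto simp: less_imp_le)
  have "0 < p \<bullet> (P *\<^sub>v p) + q \<bullet> (P *\<^sub>v q)"
    using nz pos[OF p] pos[OF q] nonneg[OF p] nonneg[OF q] by (auto intro: add_pos_nonneg add_nonneg_pos)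
  with t0 have "?t = 0" by simp
  \<comment> \<open>Once the imaginary part of the eigenvalue is zero, the equations for
    \<open>p\<close> and \<open>q\<close> decouple, and whichever of the two is nonzero serves as a
    real eigenvector.\<close>
  then have "\<mu> = complex_of_real ?s" and "H *\<^sub>v p = ?s \<cdot>\<^sub>v (P *\<^sub>v p)" and "H *\<^sub>v q = ?s \<cdot>\<^sub>v (P *\<^sub>v q)"
    using Hp Hq Pp Pq by (auto simp: complex_eq_iff intro!: eq_vecI)
  with nz p q that show thesis by blast
qed

section \<open>The Rayleigh quotient estimate\<close>

lemma scalar_prod_mat_diag:
  fixes x :: "real vec"
  assumes "x \<in> carrier_vec n"
  shows "x \<bullet> (mat_diag n f *\<^sub>v x) = (\<Sum>j<n. f j * (x $ j)\<^sup>2)"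
proof -
  have "(mat_diag n f *\<^sub>v x) $ i = f i * x $ i" if "i < n" for i
    using assms that by (simp add: mat_diag_def scalar_prod_def if_distrib[of "\<lambda>t. t * _"] cong: if_cong)
  then have "x $ i * (mat_diag n f *\<^sub>v x) $ i = f i * (x $ i)\<^sup>2" if "i < n" for i
    using that by (simp only: power2_eq_square mult.left_commute)
  moreover have "dim_vec (mat_diag n f *\<^sub>v x) = n" by (simp add: mat_diag_def)
  ultimately show ?thesis unfolding scalar_prod_def by (simp only: atLeast0LessThan) simp
qed

text \<open>
  The constant \<open>K\<close> bounds the coefficients both of the cross term and of the term on the
  indices with \<open>f j \<ge> C\<close>; these two terms are absorbed separately by the AM--GM inequality.
\<close>

lemma weighted_quadratic_form_bound:
  fixes f :: "nat \<Rightarrow> real" and K M C \<delta> :: real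
  assumes A: "A \<in> carrier_mat m n" and m: "0 < m" and n: "0 < n"
    and \<rho>: "\<rho> = real m / real n"
    and f: "\<And>j. 0 \<le> f j" and C: "0 < C" and \<delta>: "0 < \<delta>"
    and P2: "property_P2 A (card {j. j < n \<and> f j < C}) \<delta>"
    and M: "\<And>z. z \<in> carrier_vec n \<Longrightarrow> (A *\<^sub>v z) \<bullet> (A *\<^sub>v z) \<le> M * (z \<bullet> z)"
    and K: "M \<le> K" "\<rho> \<le> K"
    and x: "x \<in> carrier_vec n"
  shows "\<bar>(A *\<^sub>v x) \<bullet> (A *\<^sub>v x) - \<rho> * (x \<bullet> x)\<bar>
    \<le> (\<delta> + 1/4 * (K\<^sup>2 / (\<rho> * \<delta> * C))) * ((\<Sum>j<n. f j * (x $ j)\<^sup>2) + \<rho> * (x \<bullet> x))"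
proof -
  let ?S = "{j. j < n \<and> f j < C}"
  define y where "y = vec n (\<lambda>j. if f j < C then x $ j else 0)"
  define z where "z = vec n (\<lambda>j. if f j < C then 0 else x $ j)"
  have y: "y \<in> carrier_vec n" and z: "z \<in> carrier_vec n" by (auto simp: y_def z_def)
  have x_eq: "x = y + z" using x by (intro eq_vecI) (auto simp: y_def z_def)
  have orth: "y \<bullet> z = 0" by (simp add: scalar_prod_def y_def z_def sum.neutral)
  have exp: "(v + w) \<bullet> (v + w) = v \<bullet> v + 2 * (v \<bullet> w) + w \<bullet> w"
    if v: "v \<in> carrier_vec k" and w: "w \<in> carrier_vec k" for v w :: "real vec" and k
    using v w comm_scalar_prod[OF w v]
    by (simp add: add_scalar_prod_distrib[of _ k] scalar_prod_add_distrib[of _ k])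
  define a where "a = vec_norm2 y"
  define b where "b = vec_norm2 z"
  have a: "0 \<le> a" "y \<bullet> y = a\<^sup>2" and b: "0 \<le> b" "z \<bullet> z = b\<^sup>2"
    by (simp_all add: a_def b_def vec_norm2_nonneg vec_norm2_power2)
  have xx: "x \<bullet> x = a\<^sup>2 + b\<^sup>2" unfolding x_eq exp[OF y z] by (simp add: orth a b)
  have \<rho>_pos: "0 < \<rho>" using m n \<rho> by simp
  then have K_pos: "0 < K" using K by simp
  have Ax: "(A *\<^sub>v x) \<bullet> (A *\<^sub>v x) = (A *\<^sub>v y) \<bullet> (A *\<^sub>v y) + 2 * ((A *\<^sub>v y) \<bullet> (A *\<^sub>v z)) + (A *\<^sub>v z) \<bullet> (A *\<^sub>v z)"
    using A y z exp[of "A *\<^sub>v y" m "A *\<^sub>v z"] by (simp add: x_eq mult_add_distrib_mat_vec[of _ m n])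
  have 1: "\<bar>(A *\<^sub>v y) \<bullet> (A *\<^sub>v y) - \<rho> * a\<^sup>2\<bar> \<le> \<rho> * \<delta> * a\<^sup>2"
    using property_P2_quadratic_form[OF A m n P2 _ y] unfolding \<rho> a(2)[symmetric] by (auto simp: y_def)
  \<comment> \<open>The supports of \<open>y\<close> and \<open>z\<close> are disjoint, so the
    sharper bound for images of orthogonal vectors applies to the cross term.\<close>
  have "M * (a * b) \<le> K * (a * b)" using K a b by (intro mult_right_mono) auto
  then have 2: "\<bar>2 * ((A *\<^sub>v y) \<bullet> (A *\<^sub>v z))\<bar> \<le> K * (a * b)"
    using scalar_prod_image_orthogonal_le[OF A y z M orth] by (simp add: a_def b_def)
  \<comment> \<open>Both terms of the difference below lie between 0 and
    \<open>K * b\<^sup>2\<close>, hence so does its absolute value, and their bounds need not be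
    added.\<close>
  have "M * b\<^sup>2 \<le> K * b\<^sup>2" "\<rho> * b\<^sup>2 \<le> K * b\<^sup>2" "0 \<le> \<rho> * b\<^sup>2"
    using K \<rho>_pos by (auto intro: mult_right_mono)
  then have 3: "\<bar>(A *\<^sub>v z) \<bullet> (A *\<^sub>v z) - \<rho> * b\<^sup>2\<bar> \<le> K * b\<^sup>2"
    using M[OF z] scalar_prod_self_nonneg[of "A *\<^sub>v z"] by (simp add: b)
  have num: "\<bar>(A *\<^sub>v x) \<bullet> (A *\<^sub>v x) - \<rho> * (x \<bullet> x)\<bar> \<le> \<rho> * \<delta> * a\<^sup>2 + K * (a * b) + K * b\<^sup>2"
    using 1 2 3 by (simp add: Ax xx algebra_simps)
  have "C * b\<^sup>2 = (\<Sum>j<n. C * (z $ j)\<^sup>2)"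
    unfolding b(2)[symmetric] using z
    by (simp add: scalar_prod_def sum_distrib_left atLeast0LessThan power2_eq_square)
  also have "\<dots> \<le> (\<Sum>j<n. f j * (x $ j)\<^sup>2)"
    using f by (intro sum_mono) (auto simp: z_def intro!: mult_right_mono)
  finally have den: "C * b\<^sup>2 + \<rho> * (a\<^sup>2 + b\<^sup>2) \<le> (\<Sum>j<n. f j * (x $ j)\<^sup>2) + \<rho> * (x \<bullet> x)"
    by (simp add: xx)
  \<comment> \<open>Chosen so that \<open>4 * \<delta> * c * \<rho> * C = K\<^sup>2\<close>; this
    makes the differences of both sides in the next two estimates multiples of squares.\<close>
  define c where "c = 1/4 * (K\<^sup>2 / (\<rho> * \<delta> * C))"
  have "K * (a * b) \<le> \<delta> * C * b\<^sup>2 + c * \<rho> * a\<^sup>2"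
  proof -
    have "0 \<le> (2 * \<delta> * C * b - K * a)\<^sup>2 / (4 * \<delta> * C)" using \<delta> C by simp
    also have "\<dots> = \<delta> * C * b\<^sup>2 + c * \<rho> * a\<^sup>2 - K * (a * b)"
      using \<delta> C \<rho>_pos by (simp add: c_def divide_simps power2_eq_square) (simp add: algebra_simps)
    finally show ?thesis by simp
  qed
  moreover have "K * b\<^sup>2 \<le> \<delta> * \<rho> * b\<^sup>2 + c * C * b\<^sup>2"
  proof -
    have "0 \<le> (2 * \<delta> * \<rho> - K)\<^sup>2 * b\<^sup>2 / (4 * \<delta> * \<rho>)" using \<delta> \<rho>_pos by simp
    also have "\<dots> = \<delta> * \<rho> * b\<^sup>2 + c * C * b\<^sup>2 - K * b\<^sup>2"
      using \<delta> C \<rho>_pos by (simp add: c_def divide_simps power2_eq_square) (simp add: algebra_simps)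
    finally show ?thesis by simp
  qed
  \<comment> \<open>The one term left over when \<open>(\<delta> + c) * (C * b\<^sup>2 + \<rho> *
    (a\<^sup>2 + b\<^sup>2))\<close> is expanded and the others are matched.\<close>
  moreover have "0 \<le> c * \<rho> * b\<^sup>2" using \<delta> C \<rho>_pos by (simp add: c_def)
  ultimately have "\<rho> * \<delta> * a\<^sup>2 + K * (a * b) + K * b\<^sup>2 \<le> (\<delta> + c) * (C * b\<^sup>2 + \<rho> * (a\<^sup>2 + b\<^sup>2))"
    by (simp add: algebra_simps)
  also have "\<dots> \<le> (\<delta> + c) * ((\<Sum>j<n. f j * (x $ j)\<^sup>2) + \<rho> * (x \<bullet> x))"
    using den \<delta> C \<rho>_pos by (intro mult_left_mono) (auto simp: c_def)
  finally show ?thesis using num by (simp add: c_def)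
qed

text \<open>The product \<open>?I * ?H\<close> need not be symmetric, but its eigenvalues are those
  of the pencil of the symmetric \<open>?H\<close> and the positive definite \<open>?P\<close>. A
  real eigenvector of the pencil turns the bound on quadratic forms into one on the
  eigenvalue.\<close>

lemma preconditioned_eigenvalue_bound:
  fixes f :: "nat \<Rightarrow> real" and K M C \<delta> :: real
  assumes A: "A \<in> carrier_mat m n" and m: "0 < m" and n: "0 < n"
    and \<rho>: "\<rho> = real m / real n"
    and f: "\<And>j. 0 < f j" and C: "0 < C" and \<delta>: "0 < \<delta>"
    and P2: "property_P2 A (card {j. j < n \<and> f j < C}) \<delta>"
    and M: "\<And>z. z \<in> carrier_vec n \<Longrightarrow> (A *\<^sub>v z) \<bullet> (A *\<^sub>v z) \<le> M * (z \<bullet> z)"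
    and K: "M \<le> K" "\<rho> \<le> K"
    and ev: "\<mu> \<in># eigenvalues_mset
      (mat_inv (mat_diag n (\<lambda>j. f j + \<rho>)) * (mat_diag n f + transpose_mat A * A))"
  shows "cmod (\<mu> - 1) \<le> \<delta> + 1/4 * (K\<^sup>2 / (\<rho> * \<delta> * C))"
proof -
  let ?P = "mat_diag n (\<lambda>j. f j + \<rho>)" and ?H = "mat_diag n f + transpose_mat A * A"
  let ?I = "mat_diag n (\<lambda>j. inverse (f j + \<rho>))"
  have \<rho>_pos: "0 < \<rho>" using m n \<rho> by simp
  have fr: "0 < f j + \<rho>" for j using f[of j] \<rho>_pos by simp
  have I: "mat_inv ?P = ?I" using fr by (intro mat_inv_mat_diag) (simp add: less_imp_neq[THEN not_sym])
  have G: "transpose_mat A * A \<in> carrier_mat n n" using A by simp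
  then have H: "?H \<in> carrier_mat n n" by simp
  have P: "?P \<in> carrier_mat n n" by simp
  have N: "?I * ?H \<in> carrier_mat n n" using mult_carrier_mat[OF mat_diag_dim H] .
  have PI: "?P * ?I = 1\<^sub>m n"
    using fr by (simp add: less_imp_neq[THEN not_sym])
  have PN: "?P * (?I * ?H) = ?H"
    by (simp only: assoc_mult_mat[OF P mat_diag_dim H, symmetric] PI left_mult_one_mat[OF H])
  have symD: "transpose_mat (mat_diag n g) = mat_diag n g" for g :: "nat \<Rightarrow> real"
    by (intro eq_matI) (auto simp: mat_diag_def)
  have symH: "transpose_mat ?H = ?H"
    using A G by (simp add: transpose_add[of _ n n] symD transpose_mult[of _ n m _ n])
  have form: "x \<bullet> (?P *\<^sub>v x) = (\<Sum>j<n. f j * (x $ j)\<^sup>2) + \<rho> * (x \<bullet> x)" if x: "x \<in> carrier_vec n" for x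
  proof -
    have "x \<bullet> x = (\<Sum>j<n. (x $ j)\<^sup>2)"
      using x by (simp add: scalar_prod_def atLeast0LessThan power2_eq_square)
    then show ?thesis
      by (simp add: scalar_prod_mat_diag[OF x] distrib_right sum.distrib sum_distrib_left)
  qed
  have pos: "0 < x \<bullet> (?P *\<^sub>v x)" if x: "x \<in> carrier_vec n" "x \<noteq> 0\<^sub>v n" for x
    unfolding form[OF x(1)] using f scalar_prod_self_pos[OF x] \<rho>_pos
    by (intro add_nonneg_pos sum_nonneg) (auto simp: less_imp_le)
  have "eigenvalue (map_mat complex_of_real (?I * ?H)) \<mu>"
    using ev in_eigenvalues_mset_iff[OF N] unfolding I by simp
  from symmetric_definite_pencil_real_eigenvalue[OF H symH P symD pos N PN this]
  obtain s x where s: "\<mu> = complex_of_real s" and x: "x \<in> carrier_vec n" "x \<noteq> 0\<^sub>v n"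
    and eq: "?H *\<^sub>v x = s \<cdot>\<^sub>v (?P *\<^sub>v x)" by blast
  let ?Q = "x \<bullet> (?P *\<^sub>v x)"
  have "s * ?Q = x \<bullet> (?H *\<^sub>v x)"
    using scalar_prod_smult_distrib[OF x(1) mult_mat_vec_carrier[OF P x(1)]] unfolding eq by simp
  also have "\<dots> = x \<bullet> (mat_diag n f *\<^sub>v x) + x \<bullet> ((transpose_mat A * A) *\<^sub>v x)"
    unfolding add_mult_distrib_mat_vec[OF mat_diag_dim G x(1)]
    by (rule scalar_prod_add_distrib[OF x(1) mult_mat_vec_carrier[OF mat_diag_dim x(1)]
          mult_mat_vec_carrier[OF G x(1)]])
  also have "\<dots> = (\<Sum>j<n. f j * (x $ j)\<^sup>2) + (A *\<^sub>v x) \<bullet> (A *\<^sub>v x)"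
    by (simp add: scalar_prod_mat_diag[OF x(1)] scalar_prod_gram[OF A x(1) x(1)])
  \<comment> \<open>The weighted sum with \<open>f\<close> occurs in the forms of both
    \<open>?H\<close> and \<open>?P\<close> and cancels.\<close>
  finally have "(s - 1) * ?Q = (A *\<^sub>v x) \<bullet> (A *\<^sub>v x) - \<rho> * (x \<bullet> x)"
    by (simp add: form[OF x(1)] left_diff_distrib)
  then have "\<bar>s - 1\<bar> * ?Q = \<bar>(A *\<^sub>v x) \<bullet> (A *\<^sub>v x) - \<rho> * (x \<bullet> x)\<bar>"
    using pos[OF x] by (metis abs_mult abs_of_pos)
  also have "\<dots> \<le> (\<delta> + 1/4 * (K\<^sup>2 / (\<rho> * \<delta> * C))) * ?Q"
    unfolding form[OF x(1)] using f less_imp_le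
    by (intro weighted_quadratic_form_bound[OF A m n \<rho> _ C \<delta> P2 M K x(1)]) auto
  finally have "\<bar>s - 1\<bar> \<le> \<delta> + 1/4 * (K\<^sup>2 / (\<rho> * \<delta> * C))"
    using pos[OF x] by (simp only: mult_le_cancel_right_pos)
  moreover have "\<mu> - 1 = complex_of_real (s - 1)" by (simp add: s)
  ultimately show ?thesis by (metis norm_of_real)
qed

theorem theorem4:
  fixes m n :: nat and \<rho> :: real
    and A \<Theta>u \<Theta>v \<Theta> H P Ht Pt :: "real mat"
  assumes "0 < m" and "m < n"
    and "\<rho> = real m / real n"
    and "A \<in> carrier_mat m n"
    and "pos_diag_mat n \<Theta>u" and "pos_diag_mat n \<Theta>v"
    and "H = four_block_mat (mat_inv \<Theta>u) (0\<^sub>m n n) (0\<^sub>m n n) (mat_inv \<Theta>v)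
             + four_block_mat (transpose_mat A * A) (- (transpose_mat A * A))
                              (- (transpose_mat A * A)) (transpose_mat A * A)"
    and "P = four_block_mat (mat_inv \<Theta>u + \<rho> \<cdot>\<^sub>m 1\<^sub>m n) (- (\<rho> \<cdot>\<^sub>m 1\<^sub>m n))
                            (- (\<rho> \<cdot>\<^sub>m 1\<^sub>m n)) (mat_inv \<Theta>v + \<rho> \<cdot>\<^sub>m 1\<^sub>m n)"
    and "\<Theta> = \<Theta>u + \<Theta>v"
    and "Ht = mat_inv \<Theta> + transpose_mat A * A"
    and "Pt = mat_inv \<Theta> + \<rho> \<cdot>\<^sub>m 1\<^sub>m n"
  shows "invertible_mat P \<and> invertible_mat Pt
    \<and> eigenvalues_mset (mat_inv P * H)
        = replicate_mset n 1 + eigenvalues_mset (mat_inv Pt * Ht)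
    \<and> (\<forall>C \<delta>\<^sub>l l.
          real m \<le> real n / 2 \<longrightarrow> 0 < C \<longrightarrow> 0 < \<delta>\<^sub>l \<longrightarrow>
          l = card {j. j < n \<and> inverse (\<Theta> $$ (j, j)) < C} \<longrightarrow>
          property_P2 A l \<delta>\<^sub>l \<longrightarrow>
          (\<forall>\<mu> \<in># eigenvalues_mset (mat_inv Pt * Ht).
             (A * transpose_mat A = 1\<^sub>m m \<longrightarrow>
                cmod (\<mu> - 1) \<le> \<delta>\<^sub>l + 1/4 * ((3 - \<rho>)\<^sup>2 / (\<rho> * \<delta>\<^sub>l * C)))
           \<and> (\<forall>\<delta>. 0 \<le> \<delta> \<longrightarrow> property_P1 A \<delta> \<longrightarrow>
                cmod (\<mu> - 1) \<le> \<delta>\<^sub>l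
                  + 1/4 * ((1 + \<delta> - \<rho> + 2 * sqrt (1 + \<delta>))\<^sup>2 / (\<rho> * \<delta>\<^sub>l * C)))))"
proof -
  note m = assms(1) and \<rho> = assms(3) and A = assms(4)
  have n: "0 < n" and \<rho>_pos: "0 < \<rho>" and \<rho>_less: "\<rho> < 1" using assms(1-3) by auto
  obtain u where u: "\<Theta>u = mat_diag n u" "\<And>i. 0 < u i" using assms(5) by (rule pos_diag_mat_obtain) blast
  obtain v where v: "\<Theta>v = mat_diag n v" "\<And>i. 0 < v i" using assms(6) by (rule pos_diag_mat_obtain) blast
  define d where "d = (\<lambda>i. inverse (u i))"
  define e where "e = (\<lambda>i. inverse (v i))"
  define f where "f = (\<lambda>i. inverse (u i + v i))"
  let ?G = "transpose_mat A * A"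
  have G: "?G \<in> carrier_mat n n" using A by simp
  have d: "0 < d i" and e: "0 < e i" and f: "0 < f i" for i
    using u(2)[of i] v(2)[of i] by (auto simp: d_def e_def f_def)
  have \<Theta>: "\<Theta> = mat_diag n (\<lambda>i. u i + v i)"
    unfolding assms(9) u v by (intro eq_matI) (auto simp: mat_diag_def)
  have ne: "u i \<noteq> 0" "v i \<noteq> 0" "u i + v i \<noteq> 0" for i
    using u(2)[of i] v(2)[of i] by linarith+
  have inv: "mat_inv \<Theta>u = mat_diag n d" "mat_inv \<Theta>v = mat_diag n e" "mat_inv \<Theta> = mat_diag n f"
    using ne by (simp_all add: u v \<Theta> mat_inv_mat_diag d_def e_def f_def)
  have H: "H = four_block_mat (mat_diag n d + ?G) (- ?G) (- ?G) (mat_diag n e + ?G)"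
    unfolding assms(7) inv using G by (subst add_four_block_mat[of _ n n _ n _ n]) auto
  have shift: "mat_diag n g + \<rho> \<cdot>\<^sub>m 1\<^sub>m n = mat_diag n (\<lambda>i. g i + \<rho>)" for g
    by (intro eq_matI) (auto simp: mat_diag_def)
  have neg: "- (\<rho> \<cdot>\<^sub>m 1\<^sub>m n) = mat_diag n (\<lambda>i. - \<rho>)"
    by (intro eq_matI) (auto simp: mat_diag_def)
  have P: "P = four_block_mat (mat_diag n (\<lambda>i. d i + \<rho>)) (mat_diag n (\<lambda>i. - \<rho>))
      (mat_diag n (\<lambda>i. - \<rho>)) (mat_diag n (\<lambda>i. e i + \<rho>))"
    unfolding assms(8) inv shift neg ..
  have Ht: "Ht = mat_diag n f + ?G" and Pt: "Pt = mat_diag n (\<lambda>i. f i + \<rho>)"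
    unfolding assms(10,11) inv shift by simp_all
  have f_eq: "f i = inverse (inverse (d i) + inverse (e i))" for i by (simp add: f_def d_def e_def)
  note spectrum = preconditioned_block_spectrum[of d e, OF d e less_imp_le[OF \<rho>_pos] G, folded f_eq, folded P H Pt Ht]
  have inv_Pt: "invertible_mat Pt"
  proof (rule invertible_matI_right_inverse)
    have "f i + \<rho> \<noteq> 0" for i using f[of i] \<rho>_pos by simp
    then show "Pt * mat_diag n (\<lambda>i. inverse (f i + \<rho>)) = 1\<^sub>m n" unfolding Pt by simp
  qed (auto simp: Pt)
  have P1_bound: "cmod (\<mu> - 1) \<le> \<delta>\<^sub>l + 1/4 * ((1 + \<delta> - \<rho> + 2 * sqrt (1 + \<delta>))\<^sup>2 / (\<rho> * \<delta>\<^sub>l * C))"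
    if C: "0 < C" and \<delta>\<^sub>l: "0 < \<delta>\<^sub>l"
      and P2: "property_P2 A (card {j. j < n \<and> inverse (\<Theta> $$ (j, j)) < C}) \<delta>\<^sub>l"
      and \<mu>: "\<mu> \<in># eigenvalues_mset (mat_inv Pt * Ht)" and \<delta>: "0 \<le> \<delta>" and P1: "property_P1 A \<delta>"
    for C \<delta>\<^sub>l \<delta> \<mu>
  \<comment> \<open>Applied with \<open>M = 1 + \<delta>\<close> and
    \<open>K = 1 + \<delta> - \<rho> + 2 * sqrt (1 + \<delta>)\<close>. That \<open>K\<close>
    dominates both \<open>M\<close> and \<rho> follows from \<rho> < 1 and
    \<open>1 \<le> sqrt (1 + \<delta>)\<close>.\<close>
  proof (rule preconditioned_eigenvalue_bound[OF A m n \<rho> f C \<delta>\<^sub>l])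
    have "{j. j < n \<and> inverse (\<Theta> $$ (j, j)) < C} = {j. j < n \<and> f j < C}"
      by (auto simp: \<Theta> f_def mat_diag_def)
    then show "property_P2 A (card {j. j < n \<and> f j < C}) \<delta>\<^sub>l" using P2 by simp
    show "(A *\<^sub>v z) \<bullet> (A *\<^sub>v z) \<le> (1 + \<delta>) * (z \<bullet> z)" if "z \<in> carrier_vec n" for z
      using property_P1_norm_bound[OF A P1 \<delta> that] .
    have "1 \<le> sqrt (1 + \<delta>)" using \<delta> by simp
    then show "1 + \<delta> \<le> 1 + \<delta> - \<rho> + 2 * sqrt (1 + \<delta>)" "\<rho> \<le> 1 + \<delta> - \<rho> + 2 * sqrt (1 + \<delta>)"
      using \<rho>_less \<delta> by linarith+
    show "\<mu> \<in># eigenvalues_mset (mat_inv (mat_diag n (\<lambda>j. f j + \<rho>)) * (mat_diag n f + ?G))"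
      using \<mu> unfolding Pt Ht .
  qed
  show ?thesis
  proof (intro conjI allI impI ballI)
    fix C \<delta>\<^sub>l :: real and l :: nat and \<mu>
    assume *: "0 < C" "0 < \<delta>\<^sub>l" and l: "l = card {j. j < n \<and> inverse (\<Theta> $$ (j, j)) < C}"
      and P2: "property_P2 A l \<delta>\<^sub>l" and \<mu>: "\<mu> \<in># eigenvalues_mset (mat_inv Pt * Ht)"
    note bound = P1_bound[OF * P2[unfolded l] \<mu>]
    show "cmod (\<mu> - 1) \<le> \<delta>\<^sub>l + 1/4 * ((1 + \<delta> - \<rho> + 2 * sqrt (1 + \<delta>))\<^sup>2 / (\<rho> * \<delta>\<^sub>l * C))"
      if "0 \<le> \<delta>" "property_P1 A \<delta>" for \<delta>
      using bound[OF that] .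
    \<comment> \<open>For \<delta> = 0 the constant
      \<open>1 + \<delta> - \<rho> + 2 * sqrt (1 + \<delta>)\<close> becomes
      \<open>3 - \<rho>\<close>.\<close>
    show "cmod (\<mu> - 1) \<le> \<delta>\<^sub>l + 1/4 * ((3 - \<rho>)\<^sup>2 / (\<rho> * \<delta>\<^sub>l * C))" if "A * transpose_mat A = 1\<^sub>m m"
      using bound[OF order_refl property_P1_orthonormal[OF A that]] by simp
  qed (fact spectrum inv_Pt)+
qed

end
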